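(* Let $m, n$ be positive integers with $m < n$, and let $k_2$ be an integer with $1 \leq k_2 \leq \lfloor \frac{m}{2} \rfloor$. Then the number of ways to distribute $m$ identical balls into $n$ distinct boxes (empty boxes allowed) so that each box contains at most $k_2$ balls is $$\binom{m+n-1}{n-1} - \sum_{\alpha=1}^{\lfloor \frac{m}{k_2+1} \rfloor}(-1)^{\alpha+1} \binom{n}{\alpha} \binom{m - \alpha (k_2+1) + n - 1}{n - 1}.$$
   Context: A distribution of $m$ identical balls into $n$ distinct boxes is an $n$-tuple $(X_1,\dots,X_n)$ of nonnegative integers with $X_1+\cdots+X_n=m$ (all balls are distributed with no remainder), where $X_i$ is the number of balls in box $i$. The number of ways is the number of such tuples satisfying the stated constraints. *)

theory Defs
  imports Complex_Main
begin

(* An n-tuple is a list of length n, with box i (counted from 0) holding xs ! i balls. *)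
definition distributions :: "nat \<Rightarrow> nat \<Rightarrow> nat list set" where
  "distributions m n = {xs. length xs = n \<and> (\<Sum>i<n. xs ! i) = m}"

end

(* Impose the bound k2 on one box at a time.  A distribution that violates the bound in a given box
   becomes, after k2 + 1 balls are taken out of that box, an arbitrary distribution of
   m - (k2 + 1) balls that obeys the same bounds in the other restricted boxes.  This yields the
   recurrence N (j + 1) m = N j m - N j (m - (k2 + 1)) for the number N j m of distributions with
   j restricted boxes, which unfolds to the alternating sum by Pascal's rule. *)
theory Submission
  imports Defs
begin

text \<open>The bound covers an initial segment of the boxes so that an induction on
  \<open>j\<close> restricts one more box per step: \<open>j = 0\<close> leaves all boxes free,
  \<open>j = n\<close> restricts every box.\<close>

definition prefix_bounded :: "nat \<Rightarrow> nat \<Rightarrow> nat \<Rightarrow> nat \<Rightarrow> nat list set" where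
  "prefix_bounded n k j m = {xs. length xs = n \<and> sum_list xs = m \<and> (\<forall>i<j. xs ! i \<le> k)}"

lemma finite_prefix_bounded: "finite (prefix_bounded n k j m)"
proof (rule finite_subset)
  show "prefix_bounded n k j m \<subseteq> {xs. set xs \<subseteq> {..m} \<and> length xs = n}"
    by (auto simp: prefix_bounded_def member_le_sum_list)
qed (simp add: finite_lists_length_eq)

lemma sum_list_update_add:
  fixes xs :: "nat list"
  assumes "j < length xs"
  shows "sum_list (xs[j := xs ! j + c]) = sum_list xs + c"
  using elem_le_sum_list[OF assms] by (simp add: sum_list_update[OF assms])

text \<open>Box \<open>j\<close> lies outside the restricted boxes \<open>i < j\<close>, so changing
  its content affects only the total. Writing the total as \<open>m + Suc k\<close> avoids truncated
  subtraction.\<close>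

lemma prefix_bounded_exceeding:
  assumes "j < n"
  shows "{xs \<in> prefix_bounded n k j (m + Suc k). k < xs ! j} =
    (\<lambda>xs. xs[j := xs ! j + Suc k]) ` prefix_bounded n k j m"
proof (rule set_eqI, rule iffI)
  fix xs
  assume xs: "xs \<in> {xs \<in> prefix_bounded n k j (m + Suc k). k < xs ! j}"
  let ?ys = "xs[j := xs ! j - Suc k]"
  have len: "j < length xs"
    using xs assms by (simp add: prefix_bounded_def)
  \<comment> \<open>The subtraction in \<open>?ys\<close> is exact because
    \<open>k < xs ! j\<close>.\<close>
  have eq: "?ys[j := ?ys ! j + Suc k] = xs"
    using xs len by simp
  then have "sum_list xs = sum_list ?ys + Suc k"
    using sum_list_update_add[of j ?ys "Suc k"] len by simp
  then have "?ys \<in> prefix_bounded n k j m"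
    using xs by (auto simp: prefix_bounded_def)
  then show "xs \<in> (\<lambda>xs. xs[j := xs ! j + Suc k]) ` prefix_bounded n k j m"
    by (rule image_eqI[rotated]) (rule eq[symmetric])
next
  fix xs
  assume "xs \<in> (\<lambda>xs. xs[j := xs ! j + Suc k]) ` prefix_bounded n k j m"
  then obtain ys where ys: "ys \<in> prefix_bounded n k j m" "xs = ys[j := ys ! j + Suc k]"
    by blast
  then have "sum_list xs = m + Suc k"
    using assms sum_list_update_add[of j ys "Suc k"] by (simp only: prefix_bounded_def mem_Collect_eq)
  then show "xs \<in> {xs \<in> prefix_bounded n k j (m + Suc k). k < xs ! j}"
    using assms ys by (simp add: prefix_bounded_def)
qed

lemma card_prefix_bounded_exceeding:
  assumes "j < n"
  shows "card {xs \<in> prefix_bounded n k j (m + Suc k). k < xs ! j} = card (prefix_bounded n k j m)"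
proof -
  have "inj_on (\<lambda>xs. xs[j := xs ! j + Suc k]) (prefix_bounded n k j m)"
  proof (rule inj_on_inverseI)
    fix xs
    assume "xs \<in> prefix_bounded n k j m"
    then show "(\<lambda>ys. ys[j := ys ! j - Suc k]) (xs[j := xs ! j + Suc k]) = xs"
      using assms by (simp add: prefix_bounded_def)
  qed
  then show ?thesis
    by (simp only: prefix_bounded_exceeding[OF assms] card_image)
qed

lemma card_prefix_bounded_split:
  "card (prefix_bounded n k j m) =
    card (prefix_bounded n k (Suc j) m) + card {xs \<in> prefix_bounded n k j m. k < xs ! j}"
proof -
  have "prefix_bounded n k j m =
      prefix_bounded n k (Suc j) m \<union> {xs \<in> prefix_bounded n k j m. k < xs ! j}"
    by (auto simp: prefix_bounded_def less_Suc_eq)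
  moreover have "prefix_bounded n k (Suc j) m \<inter> {xs \<in> prefix_bounded n k j m. k < xs ! j} = {}"
    by (auto simp: prefix_bounded_def)
  ultimately show ?thesis
    by (metis (no_types, lifting) card_Un_disjoint finite_Un finite_prefix_bounded)
qed

text \<open>The case distinction matters: for \<open>m < Suc k\<close> the difference
  \<open>m - Suc k\<close> truncates to 0, and the all-zero distribution would be subtracted
  although no box can exceed \<open>k\<close>.\<close>

lemma card_prefix_bounded_Suc:
  assumes "j < n"
  shows "int (card (prefix_bounded n k (Suc j) m)) = int (card (prefix_bounded n k j m)) -
    (if Suc k \<le> m then int (card (prefix_bounded n k j (m - Suc k))) else 0)"
proof (cases "Suc k \<le> m")
  case True
  then show ?thesis
    using card_prefix_bounded_split[of n k j m]
      card_prefix_bounded_exceeding[OF assms, of k "m - Suc k"] by simp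
next
  case False
  have "xs ! j \<le> k" if "xs \<in> prefix_bounded n k j m" for xs
    using elem_le_sum_list[of j xs] that assms False by (simp add: prefix_bounded_def)
  then have none: "{xs \<in> prefix_bounded n k j m. k < xs ! j} = {}"
    by fastforce
  then show ?thesis
    using card_prefix_bounded_split[of n k j m, unfolded none] False by simp
qed

text \<open>Pascal's rule splits \<open>Suc j choose \<alpha>\<close> for positive \<alpha>; the
  part with \<open>j choose (\<alpha> - 1)\<close>, reindexed by one, is the sum for
  \<open>m - d\<close> with opposite sign.\<close>

lemma alternating_choose_sum_Suc:
  fixes g :: "nat \<Rightarrow> 'a::comm_ring_1"
  assumes "0 < d"
  shows "(\<Sum>\<alpha>\<le>m div d. (- 1) ^ \<alpha> * of_nat (Suc j choose \<alpha>) * g (m - \<alpha> * d)) =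
    (\<Sum>\<alpha>\<le>m div d. (- 1) ^ \<alpha> * of_nat (j choose \<alpha>) * g (m - \<alpha> * d)) -
    (if d \<le> m then \<Sum>\<alpha>\<le>(m - d) div d. (- 1) ^ \<alpha> * of_nat (j choose \<alpha>) * g (m - d - \<alpha> * d)
     else 0)"
proof (cases "d \<le> m")
  case True
  \<comment> \<open>Exposes a successor as upper limit, so that the term at 0 can be split off and
    the rest shifted.\<close>
  then have "m div d = Suc ((m - d) div d)"
    using assms by (simp add: le_div_geq)
  then show ?thesis
    using True
    by (simp add: sum.atMost_Suc_shift algebra_simps sum.distrib sum_negf sum_subtractf
        del: sum.atMost_Suc)
next
  case False
  then show ?thesis
    by simp
qed

lemma card_prefix_bounded:
  assumes "j \<le> n"
  shows "int (card (prefix_bounded n k j m)) =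
    (\<Sum>\<alpha>\<le>m div Suc k. (- 1) ^ \<alpha> * int (j choose \<alpha>) *
       int (card (prefix_bounded n k 0 (m - \<alpha> * Suc k))))"
  using assms
\<comment> \<open>The recurrence calls the hypothesis at both \<open>m\<close> and
  \<open>m - Suc k\<close>.\<close>
proof (induction j arbitrary: m)
  case 0
  have "(\<Sum>\<alpha>\<le>m div Suc k. (- 1) ^ \<alpha> * int (0 choose \<alpha>) *
        int (card (prefix_bounded n k 0 (m - \<alpha> * Suc k)))) =
      (\<Sum>\<alpha>\<in>{0}. (- 1) ^ \<alpha> * int (0 choose \<alpha>) *
        int (card (prefix_bounded n k 0 (m - \<alpha> * Suc k))))"
    by (rule sum.mono_neutral_right) (auto simp: binomial_eq_0)
  then show ?case
    by simp
next
  case (Suc j)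
  then have "j < n" "j \<le> n"
    by simp_all
  show ?case
    unfolding card_prefix_bounded_Suc[OF \<open>j < n\<close>] Suc.IH[OF \<open>j \<le> n\<close>]
    by (rule alternating_choose_sum_Suc[
          where g = "\<lambda>m. int (card (prefix_bounded n k 0 m))", symmetric]) simp
qed

text \<open>Stars and bars. For \<open>n = 0\<close> and positive \<open>m\<close> the truncated
  formula would give 1 instead of 0.\<close>

lemma card_prefix_bounded_0:
  assumes "0 < n"
  shows "card (prefix_bounded n k 0 m) = (m + n - 1) choose (n - 1)"
proof -
  have "card (prefix_bounded n k 0 m) = (m + n - 1) choose m"
    by (simp add: prefix_bounded_def card_length_sum_list)
  also have "\<dots> = (m + n - 1) choose (n - 1)"
    using assms binomial_symmetric[of m "m + n - 1"] by simp
  finally show ?thesis .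
qed

lemma distributions_bounded:
  "{xs \<in> distributions m n. \<forall>i<n. xs ! i \<le> k} = prefix_bounded n k n m"
  by (auto simp: distributions_def prefix_bounded_def sum_list_sum_nth atLeast0LessThan)

theorem mainTheorem7:
  fixes m n k2 :: nat
  assumes "0 < m" and "0 < n" and "m < n"
    and "1 \<le> k2" and "k2 \<le> m div 2"
  shows "int (card {xs \<in> distributions m n. \<forall>i<n. xs ! i \<le> k2}) =
    int ((m + n - 1) choose (n - 1)) -
    (\<Sum>\<alpha> = 1..m div (k2 + 1).
       (- 1) ^ (\<alpha> + 1) * int (n choose \<alpha>) * int ((m - \<alpha> * (k2 + 1) + n - 1) choose (n - 1)))"
proof -
  let ?h = "\<lambda>\<alpha>. (- 1) ^ \<alpha> * int (n choose \<alpha>) *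
    int ((m - \<alpha> * (k2 + 1) + n - 1) choose (n - 1))"
  have "int (card {xs \<in> distributions m n. \<forall>i<n. xs ! i \<le> k2}) = (\<Sum>\<alpha>\<le>m div (k2 + 1). ?h \<alpha>)"
    using card_prefix_bounded[OF order_refl, of n k2 m]
    by (simp add: distributions_bounded card_prefix_bounded_0[OF \<open>0 < n\<close>])
  \<comment> \<open>The term at 0 is the unrestricted count; the remaining terms change sign to
    match the exponent \<open>\<alpha> + 1\<close>.\<close>
  also have "\<dots> = ?h 0 + (\<Sum>\<alpha> = 1..m div (k2 + 1). ?h \<alpha>)"
    by (simp add: atMost_atLeast0 sum.atLeast_Suc_atMost)
  also have "\<dots> = int ((m + n - 1) choose (n - 1)) -
      (\<Sum>\<alpha> = 1..m div (k2 + 1). (- 1) ^ (\<alpha> + 1) * int (n choose \<alpha>) *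
        int ((m - \<alpha> * (k2 + 1) + n - 1) choose (n - 1)))"
    by (simp add: sum_negf)
  finally show ?thesis .
qed

end
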